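(* Let $p$ be a prime and let $G=UT(4,p)$. Then the reduced commuting graph $\Gamma_{\mathrm{red}}(G)$ is connected.
   Context: For a prime $p$, $UT(4,p)$ is the group, under matrix multiplication, of all $4\times 4$ upper triangular matrices over the finite field $\mathbb{F}_p$ with all diagonal entries equal to $1$. For a finite non-abelian group $G$, the commuting graph $\Gamma(G)$ has vertex set $G$, two distinct vertices $x,y$ being adjacent if and only if $xy=yx$. The reduced commuting graph $\Gamma_{\mathrm{red}}(G)$ is obtained from $\Gamma(G)$ by deleting the vertices in the center $Z(G)$ of $G$ (i.e. it is the induced subgraph on $G\setminus Z(G)$). *)

theory Defs
  imports
    "HOL-Number_Theory.Residues"
    "Jordan_Normal_Form.Matrix"
    "Graph_Theory.Digraph_Component"
begin

text \<open>
  Matrices are indexed from \<open>0\<close>.  The product is spelled out with the operations of the ring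
  record \<open>R\<close>, because the matrix product of \<open>Jordan_Normal_Form\<close> uses the type-class operations
  of the entry type, which for \<open>residue_ring p\<close> would be those of the integers.
\<close>

definition mat_mult :: "nat \<Rightarrow> ('a, 'm) ring_scheme \<Rightarrow> 'a mat \<Rightarrow> 'a mat \<Rightarrow> 'a mat" where
  "mat_mult n R A B =
     mat n n (\<lambda>(i, j). \<Oplus>\<^bsub>R\<^esub>k\<in>{..<n}. A $$ (i, k) \<otimes>\<^bsub>R\<^esub> B $$ (k, j))"

definition unitriangular_group :: "nat \<Rightarrow> ('a, 'm) ring_scheme \<Rightarrow> 'a mat monoid" where
  "unitriangular_group n R =
     \<lparr> carrier = {A \<in> carrier_mat n n.
          (\<forall>i<n. \<forall>j<n. A $$ (i, j) \<in> carrier R) \<and>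
          (\<forall>i<n. \<forall>j<i. A $$ (i, j) = \<zero>\<^bsub>R\<^esub>) \<and>
          (\<forall>i<n. A $$ (i, i) = \<one>\<^bsub>R\<^esub>)},
       monoid.mult = mat_mult n R,
       one = mat n n (\<lambda>(i, j). if i = j then \<one>\<^bsub>R\<^esub> else \<zero>\<^bsub>R\<^esub>) \<rparr>"

definition UT :: "nat \<Rightarrow> nat \<Rightarrow> int mat monoid" where
  "UT n p = unitriangular_group n (residue_ring (int p))"

definition group_center :: "('a, 'm) monoid_scheme \<Rightarrow> 'a set" where
  "group_center G = {z \<in> carrier G. \<forall>x\<in>carrier G. z \<otimes>\<^bsub>G\<^esub> x = x \<otimes>\<^bsub>G\<^esub> z}"

text \<open>An undirected edge is represented by its two opposite arcs.\<close>

definition commuting_graph :: "('a, 'm) monoid_scheme \<Rightarrow> ('a, 'a \<times> 'a) pre_digraph" where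
  "commuting_graph G = with_proj
     \<lparr> pverts = carrier G,
       parcs = {(x, y). x \<in> carrier G \<and> y \<in> carrier G \<and> x \<noteq> y \<and>
                  x \<otimes>\<^bsub>G\<^esub> y = y \<otimes>\<^bsub>G\<^esub> x} \<rparr>"

definition reduced_commuting_graph :: "('a, 'm) monoid_scheme \<Rightarrow> ('a, 'a \<times> 'a) pre_digraph" where
  "reduced_commuting_graph G = commuting_graph G \<restriction> (carrier G - group_center G)"

end

theory Submission
  imports Defs
begin

text \<open>
  The entries above the diagonal of a \<open>4 \<times> 4\<close> unitriangular matrix \<open>A\<close> are
  \<open>a = A\<^sub>0\<^sub>1\<close>, \<open>b = A\<^sub>1\<^sub>2\<close>, \<open>c = A\<^sub>2\<^sub>3\<close>, \<open>d = A\<^sub>0\<^sub>2\<close>, \<open>e = A\<^sub>1\<^sub>3\<close>, \<open>f = A\<^sub>0\<^sub>3\<close>.  Comparing the products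
  \<open>A A'\<close> and \<open>A' A\<close> entry by entry shows that \<open>A\<close> and \<open>A'\<close> commute if and only if
  \<open>a b' = a' b\<close>, \<open>b c' = b' c\<close> and \<open>a e' + d c' = a' e + d' c\<close>
  (\<open>commute_iff_entries\<close>).

  Hence the matrices with \<open>a = c = 0\<close> commute with each other, and those among them that are not
  central form a clique of the reduced commuting graph.  Every other vertex has a neighbour in this
  clique: the matrix whose only entries off the diagonal are \<open>d' = a\<close> and \<open>e' = c\<close> commutes
  with \<open>A\<close>, since the last condition becomes \<open>a c = a c\<close>, and it is not central, since \<open>a\<close> or
  \<open>c\<close> is nonzero (\<open>commutes_with_clique\<close>).  A graph in which every vertex lies in or next to a fixed
  clique is connected (\<open>connected_if_dominating_clique\<close>).

  Only ring identities and \<open>1 \<noteq> 0\<close> occur, so the lemmas are stated for a nontrivial commutative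
  ring, of which \<open>\<int>/p\<int>\<close> is an instance.
\<close>

text \<open>
  Two vertices \<open>u\<close> and \<open>v\<close> with neighbours \<open>s\<close> and \<open>t\<close> in the clique are joined by the walk
  \<open>u, s, t, v\<close>, in which consecutive vertices may coincide.
\<close>

lemma connected_if_dominating_clique:
  fixes G (structure)
  assumes clique: "\<And>x y. x \<in> S \<Longrightarrow> y \<in> S \<Longrightarrow> x \<otimes> y = y \<otimes> x"
    and noncentral: "S \<subseteq> carrier G - group_center G"
    and nonempty: "S \<noteq> {}"
    and dominating: "\<And>x. x \<in> carrier G - group_center G \<Longrightarrow> \<exists>y\<in>S. x \<otimes> y = y \<otimes> x"
  shows "Digraph_Component.connected (reduced_commuting_graph G)"
proof -
  let ?V = "carrier G - group_center G"
  let ?H = "mk_symmetric (reduced_commuting_graph G)"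
  have verts: "verts (with_proj ?H) = ?V"
    by (simp add: reduced_commuting_graph_def)
  \<comment> \<open>The graph has no loops, so a step between equal vertices is the empty walk.\<close>
  have step: "(x, y) \<in> rtrancl_on ?V (arcs_ends (with_proj ?H))"
    if "x \<in> ?V" "y \<in> ?V" "x \<otimes> y = y \<otimes> x" for x y
  proof (cases "x = y")
    case True
    then show ?thesis using that by simp
  next
    case False
    then have "(x, y) \<in> arcs_ends (with_proj ?H)"
      using that
      by (auto simp: parcs_mk_symmetric reduced_commuting_graph_def commuting_graph_def)
    then show ?thesis using that by (meson rtrancl_on_refl rtrancl_on_into_rtrancl_on)
  qed
  have "(u, v) \<in> rtrancl_on ?V (arcs_ends (with_proj ?H))" if u: "u \<in> ?V" and v: "v \<in> ?V" for u v
  proof -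
    obtain s where s: "s \<in> S" "u \<otimes> s = s \<otimes> u" using dominating u by blast
    obtain t where t: "t \<in> S" "v \<otimes> t = t \<otimes> v" using dominating v by blast
    have V: "s \<in> ?V" "t \<in> ?V" using s t noncentral by auto
    show ?thesis
      using step[OF u V(1) s(2)] step[OF V clique[OF s(1) t(1)]] step[OF V(2) v t(2)[symmetric]]
      by (blast intro: rtrancl_on_trans)
  qed
  then have "strongly_connected (with_proj ?H)"
    using nonempty noncentral verts by (auto simp: strongly_connected_def reachable_def)
  then show ?thesis
    by (simp add: connected_def)
qed

lemma all_less_4_iff: "(\<forall>i<4. P i) \<longleftrightarrow> P 0 \<and> P 1 \<and> P 2 \<and> P (3::nat)"
  by (auto simp: All_less_Suc numeral_eq_Suc)

lemma mat_eq_mat_iff: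
  "mat m n f = mat m n g \<longleftrightarrow> (\<forall>i<m. \<forall>j<n. f (i, j) = g (i, j))"
proof
  assume "mat m n f = mat m n g"
  then show "\<forall>i<m. \<forall>j<n. f (i, j) = g (i, j)"
    by (metis index_mat(1))
qed (auto intro!: eq_matI)

lemma lessThan_4: "{..<4} = {0, 1, 2, 3::nat}"
  by auto

context cring
begin

lemma unitriangular_entries:
  assumes "A \<in> carrier (unitriangular_group n R)"
  shows "i < n \<Longrightarrow> j < n \<Longrightarrow> A $$ (i, j) \<in> carrier R"
    and "i < n \<Longrightarrow> j < i \<Longrightarrow> A $$ (i, j) = \<zero>"
    and "i < n \<Longrightarrow> A $$ (i, i) = \<one>"
  using assms by (simp_all add: unitriangular_group_def)

text \<open>
  The three conditions come from the positions \<open>(0, 2)\<close>, \<open>(1, 3)\<close> and \<open>(0, 3)\<close>.  All other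
  positions agree for any two matrices: on the superdiagonal the product adds the entries.
\<close>

lemma commute_iff_entries:
  fixes A B
  defines "U \<equiv> unitriangular_group 4 R"
  assumes A: "A \<in> carrier U" and B: "B \<in> carrier U"
  shows "A \<otimes>\<^bsub>U\<^esub> B = B \<otimes>\<^bsub>U\<^esub> A \<longleftrightarrow>
    A $$ (0, 1) \<otimes> B $$ (1, 2) = B $$ (0, 1) \<otimes> A $$ (1, 2) \<and>
    A $$ (1, 2) \<otimes> B $$ (2, 3) = B $$ (1, 2) \<otimes> A $$ (2, 3) \<and>
    A $$ (0, 1) \<otimes> B $$ (1, 3) \<oplus> A $$ (0, 2) \<otimes> B $$ (2, 3) =
    B $$ (0, 1) \<otimes> A $$ (1, 3) \<oplus> B $$ (0, 2) \<otimes> A $$ (2, 3)"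
proof -
  note entries = unitriangular_entries[OF A[unfolded U_def]]
    unitriangular_entries[OF B[unfolded U_def]]
  have sum: "(\<Oplus>k\<in>{..<4}. X $$ (i, k) \<otimes> Y $$ (k, j)) =
      X $$ (i, 0) \<otimes> Y $$ (0, j) \<oplus> (X $$ (i, 1) \<otimes> Y $$ (1, j) \<oplus>
      (X $$ (i, 2) \<otimes> Y $$ (2, j) \<oplus> X $$ (i, 3) \<otimes> Y $$ (3, j)))"
    if "i < 4" "j < 4" "X \<in> carrier U" "Y \<in> carrier U" for X Y i j
    using that unfolding lessThan_4 U_def
    by (subst finsum_insert | simp add: unitriangular_entries[where n = 4] Pi_def)+
  have "A \<otimes>\<^bsub>U\<^esub> B = B \<otimes>\<^bsub>U\<^esub> A \<longleftrightarrow> (\<forall>i<4. \<forall>j<4.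
      (\<Oplus>k\<in>{..<4}. A $$ (i, k) \<otimes> B $$ (k, j)) = (\<Oplus>k\<in>{..<4}. B $$ (i, k) \<otimes> A $$ (k, j)))"
    by (simp add: U_def unitriangular_group_def mat_mult_def mat_eq_mat_iff)
  also have "\<dots> \<longleftrightarrow>
    A $$ (0, 1) \<otimes> B $$ (1, 2) = B $$ (0, 1) \<otimes> A $$ (1, 2) \<and>
    A $$ (1, 2) \<otimes> B $$ (2, 3) = B $$ (1, 2) \<otimes> A $$ (2, 3) \<and>
    A $$ (0, 1) \<otimes> B $$ (1, 3) \<oplus> A $$ (0, 2) \<otimes> B $$ (2, 3) =
    B $$ (0, 1) \<otimes> A $$ (1, 3) \<oplus> B $$ (0, 2) \<otimes> A $$ (2, 3)"
    \<comment> \<open>Above the diagonal, the diagonal ones contribute the same summands to \<open>A B\<close> and \<open>B A\<close>,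
      which cancel.\<close>
    by (auto simp: all_less_4_iff sum[OF _ _ A B] sum[OF _ _ B A] entries a_ac
        simp del: One_nat_def)
  finally show ?thesis .
qed

text \<open>
  The corner entry \<open>(0, 3)\<close> has no influence on commuting, so the matrices needed as witnesses
  can all have zero there.
\<close>

definition unitriangular_mat :: "'a \<Rightarrow> 'a \<Rightarrow> 'a \<Rightarrow> 'a \<Rightarrow> 'a \<Rightarrow> 'a mat" where
  "unitriangular_mat a b c d e = mat 4 4 (\<lambda>(i, j).
     if i = j then \<one>
     else if (i, j) = (0, 1) then a else if (i, j) = (1, 2) then b else if (i, j) = (2, 3) then c
     else if (i, j) = (0, 2) then d else if (i, j) = (1, 3) then e else \<zero>)"

lemma unitriangular_mat_in_carrier:
  assumes "a \<in> carrier R" "b \<in> carrier R" "c \<in> carrier R" "d \<in> carrier R" "e \<in> carrier R"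
  shows "unitriangular_mat a b c d e \<in> carrier (unitriangular_group 4 R)"
  using assms by (auto simp: unitriangular_mat_def unitriangular_group_def)

lemma unitriangular_mat_entries:
  "unitriangular_mat a b c d e $$ (0, 1) = a"
  "unitriangular_mat a b c d e $$ (1, 2) = b"
  "unitriangular_mat a b c d e $$ (2, 3) = c"
  "unitriangular_mat a b c d e $$ (0, 2) = d"
  "unitriangular_mat a b c d e $$ (1, 3) = e"
  by (simp_all add: unitriangular_mat_def)

text \<open>
  A nonzero entry at \<open>(0, 2)\<close> is detected by a matrix with a one at \<open>(2, 3)\<close>, a nonzero entry at
  \<open>(1, 3)\<close> by a matrix with a one at \<open>(0, 1)\<close>.
\<close>

lemma unitriangular_mat_noncentral:
  fixes a c
  defines "U \<equiv> unitriangular_group 4 R"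
  assumes ac: "a \<in> carrier R" "c \<in> carrier R" and nonzero: "a \<noteq> \<zero> \<or> c \<noteq> \<zero>"
  shows "unitriangular_mat \<zero> \<zero> \<zero> a c \<in> carrier U - group_center U"
proof -
  let ?W = "unitriangular_mat \<zero> \<zero> \<zero> a c"
  let ?X = "unitriangular_mat \<zero> \<zero> \<one> \<zero> \<zero>"
  let ?Y = "unitriangular_mat \<one> \<zero> \<zero> \<zero> \<zero>"
  have carrier: "?W \<in> carrier U" "?X \<in> carrier U" "?Y \<in> carrier U"
    using ac by (simp_all add: U_def unitriangular_mat_in_carrier)
  have "?W \<otimes>\<^bsub>U\<^esub> ?X = ?X \<otimes>\<^bsub>U\<^esub> ?W \<longleftrightarrow> a = \<zero>" "?W \<otimes>\<^bsub>U\<^esub> ?Y = ?Y \<otimes>\<^bsub>U\<^esub> ?W \<longleftrightarrow> c = \<zero>"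
    using carrier ac unfolding U_def
    by (auto simp: commute_iff_entries unitriangular_mat_entries simp del: One_nat_def)
  then have "?W \<notin> group_center U"
    using nonzero carrier by (auto simp: group_center_def)
  with carrier show ?thesis by simp
qed

text \<open>
  The equation \<open>a e' + d c' = a' e + d' c\<close> with \<open>a' = c' = 0\<close> reads \<open>a e' = d' c\<close>, which
  \<open>(d', e') = (a, c)\<close> solves because both sides become \<open>a c\<close>.  If \<open>a = c = 0\<close>, this solution is the
  identity matrix, but then \<open>A\<close> itself belongs to the clique.
\<close>

lemma commutes_with_clique:
  fixes A
  defines "U \<equiv> unitriangular_group 4 R"
  assumes A: "A \<in> carrier U - group_center U"
  shows "\<exists>B \<in> carrier U - group_center U.
    B $$ (0, 1) = \<zero> \<and> B $$ (2, 3) = \<zero> \<and> A \<otimes>\<^bsub>U\<^esub> B = B \<otimes>\<^bsub>U\<^esub> A"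
proof (cases "A $$ (0, 1) = \<zero> \<and> A $$ (2, 3) = \<zero>")
  case True
  then show ?thesis using A by blast
next
  case False
  let ?B = "unitriangular_mat \<zero> \<zero> \<zero> (A $$ (0, 1)) (A $$ (2, 3))"
  have A': "A \<in> carrier (unitriangular_group 4 R)" using A by (simp add: U_def)
  have entries: "A $$ (i, j) \<in> carrier R" if "i < 4" "j < 4" for i j
    using A' that by (rule unitriangular_entries)
  have B: "?B \<in> carrier U - group_center U"
    using False entries unfolding U_def by (intro unitriangular_mat_noncentral) auto
  moreover have "A \<otimes>\<^bsub>U\<^esub> ?B = ?B \<otimes>\<^bsub>U\<^esub> A"
    using A B entries unfolding U_def
    by (subst commute_iff_entries) (simp_all add: unitriangular_mat_entries del: One_nat_def)
  ultimately show ?thesis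
    using unitriangular_mat_entries by blast
qed

lemma connected_reduced_commuting_graph_unitriangular_4:
  assumes "\<one> \<noteq> \<zero>"
  shows "Digraph_Component.connected (reduced_commuting_graph (unitriangular_group 4 R))"
proof -
  let ?U = "unitriangular_group 4 R"
  let ?S = "{A \<in> carrier ?U - group_center ?U. A $$ (0, 1) = \<zero> \<and> A $$ (2, 3) = \<zero>}"
  show ?thesis
  proof (rule connected_if_dominating_clique)
    fix A B assume AB: "A \<in> ?S" "B \<in> ?S"
    then have "A \<in> carrier ?U" "B \<in> carrier ?U" by auto
    then show "A \<otimes>\<^bsub>?U\<^esub> B = B \<otimes>\<^bsub>?U\<^esub> A"
      using AB unitriangular_entries(1)[of A 4] unitriangular_entries(1)[of B 4]
      by (subst commute_iff_entries) (simp_all del: One_nat_def)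
  next
    have "unitriangular_mat \<zero> \<zero> \<zero> \<one> \<zero> \<in> ?S"
      using unitriangular_mat_noncentral[of \<one> \<zero>] assms
      by (simp add: unitriangular_mat_entries del: One_nat_def)
    then show "?S \<noteq> {}" by blast
  next
    fix A assume "A \<in> carrier ?U - group_center ?U"
    then show "\<exists>B\<in>?S. A \<otimes>\<^bsub>?U\<^esub> B = B \<otimes>\<^bsub>?U\<^esub> A"
      using commutes_with_clique by blast
  qed blast
qed

end

theorem proposition3p1:
  fixes p :: nat
  assumes "prime p"
  shows "Digraph_Component.connected (reduced_commuting_graph (UT 4 p))"
proof -
  have "1 < int p" using prime_gt_1_nat[OF assms] by simp
  then interpret residues "int p" "residue_ring (int p)" by unfold_locales simp_all
  show ?thesis
    unfolding UT_def
    by (intro connected_reduced_commuting_graph_unitriangular_4) (simp add: res_one_eq res_zero_eq)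
qed

end
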